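(* For every integer $n\ge 1$, $$\langle f,g\rangle=\langle f,g\rangle_n=\langle f,g\rangle_n^*\qquad\text{for all } f,g\in\mathcal H_n .$$
   Context: Let $\mathbb R^4_H=\{\mathbf t\in\mathbb R^4: t_1+t_2+t_3+t_4=0\}$ with its 3-dimensional Lebesgue measure $d\mathbf t$, $\mathbb Z^4_H=\mathbb Z^4\cap\mathbb R^4_H$, $\Omega_H=\{\mathbf t\in\mathbb R^4_H: -1<t_i-t_j\le1,\ 1\le i<j\le 4\}$ (volume $2$), and $\langle f,g\rangle=\frac12\int_{\Omega_H}f\bar g\,d\mathbf t$. Let $\mathbb H=\{\mathbf k\in\mathbb Z^4_H: k_1\equiv k_2\equiv k_3\equiv k_4\pmod 4\}$ and $\phi_{\mathbf k}(\mathbf t)=e^{\frac{\pi i}{2}\mathbf k\cdot\mathbf t}$. Define $\mathbb H_n=\{\mathbf k\in\mathbb H: -4n<k_i-k_j\le 4n,\ 1\le i<j\le4\}$, $\mathbb H_n^*=\{\mathbf k\in\mathbb H: -4n\le k_i-k_j\le 4n,\ 1\le i<j\le 4\}$, and $\mathcal H_n=\operatorname{span}\{\phi_{\mathbf k}:\mathbf k\in\mathbb H_n\}$. For $\mathbf k\in\mathbb H_n^*$ define the weight $c^{(n)}_{\mathbf k}=1$ if $\max_i k_i-\min_i k_i<4n$, and otherwise (when $\max_ik_i-\min_ik_i=4n$) $c^{(n)}_{\mathbf k}=1/\binom{p+q}{p}$, where $p$ is the number of coordinates of $\mathbf k$ equal to $\max_ik_i$ and $q$ the number equal to $\min_i k_i$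 (so the weight is $1/2$ on faces, $1/3$ on edges, $1/4$ or $1/6$ at vertices). Define $\langle f,g\rangle_n=\frac{1}{4n^3}\sum_{\mathbf j\in\mathbb H_n}f(\tfrac{\mathbf j}{4n})\overline{g(\tfrac{\mathbf j}{4n})}$ and $\langle f,g\rangle_n^*=\frac1{4n^3}\sum_{\mathbf j\in\mathbb H_n^*}c^{(n)}_{\mathbf j}f(\tfrac{\mathbf j}{4n})\overline{g(\tfrac{\mathbf j}{4n})}$. *)

theory Defs
  imports "HOL-Analysis.Analysis"
begin

(* Points of R^4 are vectors real^4.  The paper's coordinate indices 1,2,3,4 correspond to the
   index type elements 0,1,2,3 of type 4, ordered by its standard linear order (0<1<2<3). *)

definition RH :: "(real^4) set" where
  "RH = {t. (\<Sum>i\<in>UNIV. t $ i) = 0}"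

definition Omega_H :: "(real^4) set" where
  "Omega_H = {t \<in> RH. \<forall>i j. i < j \<longrightarrow> -1 < t $ i - t $ j \<and> t $ i - t $ j \<le> 1}"

definition embH :: "real \<times> real \<times> real \<Rightarrow> real^4" where
  "embH p = (\<chi> i. if i = 0 then fst p else if i = 1 then fst (snd p)
                 else if i = 2 then snd (snd p) else - (fst p + fst (snd p) + snd (snd p)))"

(* integral over S \<subseteq> R^4_H w.r.t. the 3-dimensional Lebesgue (surface) measure on R^4_H;
   the parametrisation embH has constant Jacobian factor sqrt(det(I + 1 1^T)) = sqrt 4 = 2 *)
definition integral_H :: "(real^4) set \<Rightarrow> (real^4 \<Rightarrow> complex) \<Rightarrow> complex" where
  "integral_H S h = 2 * integral {p. embH p \<in> S} (\<lambda>p. h (embH p))"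

definition inner_H :: "(real^4 \<Rightarrow> complex) \<Rightarrow> (real^4 \<Rightarrow> complex) \<Rightarrow> complex" where
  "inner_H f g = (1/2) * integral_H Omega_H (\<lambda>t. f t * cnj (g t))"

definition HH :: "(int^4) set" where
  "HH = {k. (\<Sum>i\<in>UNIV. k $ i) = 0 \<and> (\<forall>i j. k $ i mod 4 = k $ j mod 4)}"

definition HH_n :: "nat \<Rightarrow> (int^4) set" where
  "HH_n n = {k \<in> HH. \<forall>i j. i < j \<longrightarrow> - 4 * int n < k $ i - k $ j \<and> k $ i - k $ j \<le> 4 * int n}"

definition HH_n_star :: "nat \<Rightarrow> (int^4) set" where
  "HH_n_star n = {k \<in> HH. \<forall>i j. i < j \<longrightarrow> - 4 * int n \<le> k $ i - k $ j \<and> k $ i - k $ j \<le> 4 * int n}"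

definition phi :: "int^4 \<Rightarrow> real^4 \<Rightarrow> complex" where
  "phi k t = exp (\<i> * of_real (pi / 2 * (\<Sum>i\<in>UNIV. of_int (k $ i) * t $ i)))"

definition trig_space :: "nat \<Rightarrow> (real^4 \<Rightarrow> complex) set" where
  "trig_space n = {f. \<exists>c :: int^4 \<Rightarrow> complex. f = (\<lambda>t. \<Sum>k\<in>HH_n n. c k * phi k t)}"

definition weight :: "nat \<Rightarrow> int^4 \<Rightarrow> real" where
  "weight n k =
     (let mx = Max (range (\<lambda>i. k $ i)); mn = Min (range (\<lambda>i. k $ i));
          p = card {i. k $ i = mx}; q = card {i. k $ i = mn}
      in if mx - mn < 4 * int n then 1 else 1 / real ((p + q) choose p))"

definition grid_pt :: "nat \<Rightarrow> int^4 \<Rightarrow> real^4" where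
  "grid_pt n j = (\<chi> i. real_of_int (j $ i) / (4 * real n))"

definition inner_n :: "nat \<Rightarrow> (real^4 \<Rightarrow> complex) \<Rightarrow> (real^4 \<Rightarrow> complex) \<Rightarrow> complex" where
  "inner_n n f g = (1 / (4 * of_nat n ^ 3)) *
     (\<Sum>j\<in>HH_n n. f (grid_pt n j) * cnj (g (grid_pt n j)))"

definition inner_n_star :: "nat \<Rightarrow> (real^4 \<Rightarrow> complex) \<Rightarrow> (real^4 \<Rightarrow> complex) \<Rightarrow> complex" where
  "inner_n_star n f g = (1 / (4 * of_nat n ^ 3)) *
     (\<Sum>j\<in>HH_n_star n. of_real (weight n j) * f (grid_pt n j) * cnj (g (grid_pt n j)))"

end

(* Products f * cnj g with f, g in H_n are combinations of characters phi_m with m = k - l and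
   k, l in H_n.  Each phi_m is periodic under the root lattice Z^4_H, and Omega_H is a fundamental
   domain for this lattice: subtract the floors of the coordinates, then subtract 1 from the
   coordinates with the largest fractional parts, breaking ties by index.  Integrals of periodic
   functions agree over all fundamental domains; comparing Omega_H with a translate of itself
   kills the integral of phi_m for m nonzero, and comparing it with the unit cube gives its volume.
   In the same way H_n represents HH modulo 4n Z^4_H, so the grid sum of phi_m is invariant under
   translation and vanishes unless m lies in 4n Z^4_H, which for m = k - l means k = l.
   A class modulo 4n Z^4_H that meets the boundary has exactly (p+q choose p) members in H_n^*,
   obtained by choosing which p of the p+q extremal coordinates are maximal; hence the weights over
   each class add up to 1. *)
theory Submission
  imports Defs
begin

section \<open>Representatives modulo the root lattice: existence and uniqueness\<close>

text \<open>Greedy selection: each step adjoins the largest remaining index, ordered by value and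
  then by position. The tie rule is what later produces the half-open inequalities of the
  tile.\<close>

lemma ex_top_subset:
  fixes f :: "'n::{finite,linorder} \<Rightarrow> 'a::linorder"
  assumes "s \<le> CARD('n)"
  shows "\<exists>S. card S = s \<and> (\<forall>i\<in>S. \<forall>j. j \<notin> S \<longrightarrow> f j < f i \<or> f j = f i \<and> j < i)"
  using assms
proof (induction s)
  case 0
  show ?case by (intro exI[of _ "{}"]) auto
next
  case (Suc s)
  then obtain S where S: "card S = s" "\<And>i j. i \<in> S \<Longrightarrow> j \<notin> S \<Longrightarrow> f j < f i \<or> f j = f i \<and> j < i"
    by (metis Suc_leD)
  have "- S \<noteq> {}"
  proof
    assume "- S = {}"
    then have "S = UNIV" by auto
    with S(1) Suc.prems show False by simp
  qed
  define M where "M = Max (f ` (- S))"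
  define i where "i = Max {i \<in> - S. f i = M}"
  have "M \<in> f ` (- S)" unfolding M_def by (rule Max_in) (use \<open>- S \<noteq> {}\<close> in auto)
  then have "{i \<in> - S. f i = M} \<noteq> {}" by auto
  then have "i \<in> {i \<in> - S. f i = M}" unfolding i_def by (intro Max_in) auto
  then have i: "i \<notin> S" "f i = M" by auto
  have top: "f j < f i \<or> f j = f i \<and> j < i" if "j \<notin> S" "j \<noteq> i" for j
  proof -
    have "f j \<le> M" unfolding M_def using that by auto
    moreover have "j \<le> i" if "f j = M" unfolding i_def using that \<open>j \<notin> S\<close> by auto
    ultimately show ?thesis using i that by fastforce
  qed
  show ?case
    by (intro exI[of _ "insert i S"]) (use S i top in \<open>auto simp: card_insert_if\<close>)
qed

lemma tile_exists:
  fixes t :: "'n::{finite,linorder} \<Rightarrow> real"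
  assumes "sum t UNIV = 0"
  shows "\<exists>z::'n \<Rightarrow> int. sum z UNIV = 0 \<and>
    (\<forall>i j. i < j \<longrightarrow> -1 < (t i + of_int (z i)) - (t j + of_int (z j)) \<and>
      (t i + of_int (z i)) - (t j + of_int (z j)) \<le> 1)"
proof -
  \<comment> \<open>Since \<open>t\<close> sums to zero, \<open>s\<close> is the sum of the
    fractional parts; hence exactly \<open>s\<close> coordinates must be lowered by 1 to restore the
    zero sum.\<close>
  define s where "s = nat (- (\<Sum>i\<in>UNIV. \<lfloor>t i\<rfloor>))"
  have fr: "(\<Sum>i\<in>UNIV. frac (t i)) = - real_of_int (\<Sum>i\<in>UNIV. \<lfloor>t i\<rfloor>)"
    using assms by (simp add: frac_def sum_subtractf)
  have "(\<Sum>i\<in>UNIV. frac (t i)) \<ge> 0" by (intro sum_nonneg) auto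
  then have s: "int s = - (\<Sum>i\<in>UNIV. \<lfloor>t i\<rfloor>)" using fr unfolding s_def by linarith
  have "(\<Sum>i\<in>UNIV. frac (t i)) \<le> (\<Sum>i\<in>(UNIV::'n set). 1)"
    by (intro sum_mono) (simp add: frac_lt_1 less_imp_le)
  moreover have "real s = - real_of_int (\<Sum>i\<in>UNIV. \<lfloor>t i\<rfloor>)"
    using s by (metis of_int_minus of_int_of_nat_eq)
  ultimately have "s \<le> CARD('n)" using fr by simp
  from ex_top_subset[OF this, of "\<lambda>i. frac (t i)"] obtain S where
    S: "card S = s" "\<And>i j. i \<in> S \<Longrightarrow> j \<notin> S \<Longrightarrow> frac (t j) < frac (t i) \<or> frac (t j) = frac (t i) \<and> j < i"
    by metis
  define z where "z i = - \<lfloor>t i\<rfloor> - (if i \<in> S then 1 else 0)" for i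
  have "sum z UNIV = 0"
    using s S(1) by (simp add: z_def sum_subtractf sum_negf sum.If_cases)
  moreover have "-1 < (t i + of_int (z i)) - (t j + of_int (z j)) \<and>
      (t i + of_int (z i)) - (t j + of_int (z j)) \<le> 1" if "i < j" for i j
  proof -
    have *: "t i + of_int (z i) = frac (t i) - (if i \<in> S then 1 else 0)" for i
      by (simp add: z_def frac_def)
    \<comment> \<open>If \<open>i\<close> and \<open>j\<close> are both in \<open>S\<close> or both
      outside, the difference of two fractional parts lies strictly between -1 and 1. Otherwise the
      ordering of \<open>S\<close> decides, and for \<open>i < j\<close> a tie can only give the
      value 1, never -1.\<close>
    define x y where "x = frac (t i)" and "y = frac (t j)"
    have "0 \<le> x" "x < 1" "0 \<le> y" "y < 1" by (simp_all add: x_def y_def frac_lt_1)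
    then show ?thesis
      using S(2)[of i j] S(2)[of j i] that unfolding * x_def[symmetric] y_def[symmetric] by auto
  qed
  ultimately show ?thesis by blast
qed

text \<open>Two lattice-equivalent points of the closed tile can differ only by swapping extremal
  coordinates.\<close>
lemma closed_tile_step:
  fixes t u :: "'n::finite \<Rightarrow> 'a::linordered_idom"
  assumes c: "c > 0" and sum: "sum t UNIV = sum u UNIV"
    and lat: "\<And>i. \<exists>d::int. u i - t i = c * of_int d"
    and t: "\<And>i j. t i - t j \<le> c" and u: "\<And>i j. u i - u j \<le> c"
    and i: "u i > t i"
  shows "u i = t i + c" "\<exists>l. u l < t l \<and> t l - t i = c \<and> u i - u l = c"
proof -
  have "\<exists>l. u l < t l"
  proof (rule ccontr)
    assume "\<nexists>l. u l < t l"
    then have "sum t UNIV < sum u UNIV"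
      by (intro sum_strict_mono_ex1) (use i in \<open>auto simp: not_less\<close>)
    with sum show False by simp
  qed
  then obtain l where l: "u l < t l" ..
  obtain d where d: "u i - t i = c * of_int d" using lat by blast
  obtain e where e: "u l - t l = c * of_int e" using lat by blast
  have "c * of_int d > 0" using d i by simp
  then have d1: "d \<ge> 1" using c by (simp add: zero_less_mult_iff)
  have "c * of_int e < 0" using e l by (metis diff_less_0_iff_less)
  then have e1: "e \<le> -1" using c by (simp add: mult_less_0_iff)
  have "(1::'a) \<le> of_int d" using d1 by simp
  then have "c * 1 \<le> c * of_int d" using c by (intro mult_left_mono) auto
  \<comment> \<open>Coordinate \<open>i\<close> rises by at least \<open>c\<close> and
    \<open>l\<close> falls by at least \<open>c\<close>, so their difference moves by at least
    \<open>2 * c\<close>. Within the closed tile it can move by at most that much, so all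
    inequalities are equalities.\<close>
  then have up: "u i - t i \<ge> c" using d by simp
  have "(of_int e :: 'a) \<le> of_int (- 1)" using e1 by (simp only: of_int_le_iff)
  then have "c * of_int e \<le> c * of_int (- 1)" using c by (intro mult_left_mono) auto
  then have dn: "u l - t l \<le> - c" using e by simp
  show "u i = t i + c" using up dn t[of l i] u[of i l] by linarith
  have "t l - t i = c" "u i - u l = c" using up dn t[of l i] u[of i l] by linarith+
  then show "\<exists>l. u l < t l \<and> t l - t i = c \<and> u i - u l = c" using l by blast
qed

text \<open>If some coordinate rises, \<open>closed_tile_step\<close> makes a difference of exactly
  \<open>c\<close> appear for the pair \<open>l\<close>, \<open>i\<close> in \<open>t\<close> and
  for the reversed pair in \<open>u\<close>. The half-open inequalities allow this only when
  \<open>l < i\<close> and \<open>i < l\<close>. The general ring covers both the real tile, with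
  \<open>c = 1\<close>, and the integer grid, with \<open>c = 4 * int n\<close>.\<close>

lemma tile_unique:
  fixes t u :: "'n::{finite,linorder} \<Rightarrow> 'a::linordered_idom"
  assumes c: "c > 0" and sum: "sum t UNIV = sum u UNIV"
    and lat: "\<And>i. \<exists>d::int. u i - t i = c * of_int d"
    and t: "\<And>i j. i < j \<Longrightarrow> - c < t i - t j \<and> t i - t j \<le> c"
    and u: "\<And>i j. i < j \<Longrightarrow> - c < u i - u j \<and> u i - u j \<le> c"
  shows "t = u"
proof (rule ccontr)
  assume "t \<noteq> u"
  have "\<exists>i. u i > t i"
  proof (rule ccontr)
    assume "\<nexists>i. u i > t i"
    then have le: "u i \<le> t i" for i by (simp add: not_less)
    moreover have "\<exists>i. u i < t i" using \<open>t \<noteq> u\<close> le by (metis ext order.not_eq_order_implies_strict)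
    ultimately have "sum u UNIV < sum t UNIV"
      by (intro sum_strict_mono_ex1) auto
    with sum show False by simp
  qed
  then obtain i where i: "u i > t i" ..
  have tc: "t i - t j \<le> c" for i j
    using t[of i j] t[of j i] c by (cases i j rule: linorder_cases) (auto simp: algebra_simps)
  have uc: "u i - u j \<le> c" for i j
    using u[of i j] u[of j i] c by (cases i j rule: linorder_cases) (auto simp: algebra_simps)
  obtain l where l: "t l - t i = c" "u i - u l = c"
    using closed_tile_step(2)[OF c sum lat tc uc i] by blast
  show False
    using t[of i l] u[of l i] c l by (cases i l rule: linorder_cases) (auto simp: algebra_simps)
qed

section \<open>The grids \<open>HH_n\<close> and \<open>HH_n_star\<close> and their lattice
  classes\<close>

text \<open>In the index type \<open>4\<close> the numerals 4 and 0 coincide, so the expansion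
  \<open>sum_4\<close> only has to be reordered.\<close>

lemma sum_UNIV_4: "sum f (UNIV::4 set) = f 0 + f 1 + f 2 + (f 3 :: 'a::comm_monoid_add)"
proof -
  have "(4::4) = 0" by simp
  then show ?thesis using sum_4[of f] by (simp only: ac_simps)
qed

lemma all_UNIV_4: "(\<forall>i::4. P i) \<longleftrightarrow> P 0 \<and> P 1 \<and> P 2 \<and> P 3"
proof -
  have "(4::4) = 0" by simp
  then show ?thesis unfolding forall_4 by metis
qed

lemma vec_eq_iff_4: "(x = y) \<longleftrightarrow> x $ 0 = y $ 0 \<and> x $ 1 = y $ 1 \<and> x $ 2 = y $ 2 \<and> x $ (3::4) = y $ 3"
  unfolding vec_eq_iff all_UNIV_4 ..

text \<open>For vectors whose coordinates sum to zero, this is congruence modulo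
  \<open>4 * n\<close> times the lattice of zero-sum integer vectors.\<close>
definition lat_eq :: "nat \<Rightarrow> int^4 \<Rightarrow> int^4 \<Rightarrow> bool" where
  "lat_eq n j k \<longleftrightarrow> (\<forall>i. 4 * int n dvd k $ i - j $ i)"

lemma lat_eq_refl [simp]: "lat_eq n j j"
  by (simp add: lat_eq_def)

lemma lat_eq_sym: "lat_eq n j k \<Longrightarrow> lat_eq n k j"
  by (simp add: lat_eq_def dvd_diff_commute)

lemma lat_eq_trans: "lat_eq n j k \<Longrightarrow> lat_eq n k l \<Longrightarrow> lat_eq n j l"
  unfolding lat_eq_def using dvd_add[of "4 * int n" "k $ i - j $ i" "l $ i - k $ i" for i] by simp

lemma HH_sum: "k \<in> HH \<Longrightarrow> (\<Sum>i\<in>UNIV. k $ i) = 0"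
  by (simp add: HH_def)

lemma HH_mod: "k \<in> HH \<Longrightarrow> k $ i mod 4 = k $ j mod 4"
  by (auto simp: HH_def)

lemma HH_add: "j \<in> HH \<Longrightarrow> k \<in> HH \<Longrightarrow> j + k \<in> HH"
  unfolding HH_def by (auto simp: sum.distrib) (metis mod_add_cong)

lemma HH_diff: "j \<in> HH \<Longrightarrow> k \<in> HH \<Longrightarrow> j - k \<in> HH"
  unfolding HH_def by (auto simp: sum_subtractf) (metis mod_diff_cong)

lemma HH_shift:
  assumes "j \<in> HH" "(\<Sum>i\<in>UNIV. z i) = (0::int)"
  shows "(\<chi> i. j $ i + 4 * int n * z i) \<in> HH"
proof -
  have "(j $ i + 4 * int n * z i) mod 4 = j $ i mod 4" for i
    by (simp add: mult.assoc)
  then show ?thesis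
    using assms by (simp add: HH_def sum.distrib flip: sum_distrib_left)
qed

lemma HH_n_subset: "HH_n n \<subseteq> HH_n_star n"
  unfolding HH_n_def HH_n_star_def by force

lemma HH_n_star_HH: "j \<in> HH_n_star n \<Longrightarrow> j \<in> HH"
  by (simp add: HH_n_star_def)

lemma HH_n_HH: "j \<in> HH_n n \<Longrightarrow> j \<in> HH"
  by (simp add: HH_n_def)

text \<open>The closed bounds are symmetric in the two indices, so the order of indices can be
  forgotten.\<close>

lemma HH_n_star_iff: "j \<in> HH_n_star n \<longleftrightarrow> j \<in> HH \<and> (\<forall>i l. j $ i - j $ l \<le> 4 * int n)"
proof -
  have "j $ i - j $ l \<le> 4 * int n" if "j \<in> HH_n_star n" for i l
    using that unfolding HH_n_star_def
    by (cases i l rule: linorder_cases) (force simp: algebra_simps)+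
  moreover have "- 4 * int n \<le> j $ i - j $ l" if "j $ l - j $ i \<le> 4 * int n" for i l
    using that by simp
  ultimately show ?thesis unfolding HH_n_star_def by blast
qed

text \<open>\<open>tile_exists\<close> applies to the real point \<open>j / (4n)\<close>; shifting
  it by an integer vector \<open>z\<close> shifts \<open>j\<close> by \<open>4n z\<close>, which
  keeps residues modulo 4.\<close>

lemma HH_n_exists:
  assumes "n \<ge> 1" "j \<in> HH"
  shows "\<exists>k \<in> HH_n n. lat_eq n j k"
proof -
  have "(\<Sum>i\<in>UNIV. real_of_int (j $ i) / (4 * real n)) = 0"
    using HH_sum[OF assms(2)] by (simp flip: sum_divide_distrib of_int_sum)
  from tile_exists[OF this] obtain z :: "4 \<Rightarrow> int" where z: "(\<Sum>i\<in>UNIV. z i) = 0"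
    "\<And>i l. i < l \<Longrightarrow> -1 < (real_of_int (j $ i) / (4 * real n) + of_int (z i)) - (real_of_int (j $ l) / (4 * real n) + of_int (z l))
      \<and> (real_of_int (j $ i) / (4 * real n) + of_int (z i)) - (real_of_int (j $ l) / (4 * real n) + of_int (z l)) \<le> 1"
    by blast
  define k where "k = (\<chi> i. j $ i + 4 * int n * z i)"
  have "k \<in> HH" unfolding k_def using assms(2) z(1) by (rule HH_shift)
  moreover have "- 4 * int n < k $ i - k $ l \<and> k $ i - k $ l \<le> 4 * int n" if "i < l" for i l
  proof -
    have eq: "(real_of_int (j $ i) / (4 * real n) + of_int (z i)) - (real_of_int (j $ l) / (4 * real n) + of_int (z l))
      = real_of_int (k $ i - k $ l) / (4 * real n)"
      using assms(1) by (simp add: k_def field_simps)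
    have "- real (4 * n) < real_of_int (k $ i - k $ l)" "real_of_int (k $ i - k $ l) \<le> real (4 * n)"
      using z(2)[OF that] assms(1) unfolding eq by (auto simp: field_simps)
    then show ?thesis by linarith
  qed
  ultimately have "k \<in> HH_n n" by (simp add: HH_n_def)
  moreover have "lat_eq n j k" by (simp add: lat_eq_def k_def)
  ultimately show ?thesis by blast
qed

lemma lat_eq_dvdD: "lat_eq n j k \<Longrightarrow> \<exists>d::int. k $ i - j $ i = 4 * int n * of_int d"
  unfolding lat_eq_def dvd_def by auto

lemma HH_n_unique:
  assumes "n \<ge> 1" "j \<in> HH_n n" "k \<in> HH_n n" "lat_eq n j k"
  shows "j = k"
proof -
  have "($) j = ($) k"
  proof (rule tile_unique[of "4 * int n"])
    show "sum (($) j) UNIV = sum (($) k) UNIV"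
      using assms HH_sum HH_n_HH by metis
    show "\<And>i. \<exists>d. k $ i - j $ i = 4 * int n * of_int d" using lat_eq_dvdD[OF assms(4)] .
  qed (use assms in \<open>auto simp: HH_n_def\<close>)
  then show ?thesis by (simp add: vec_eq_iff)
qed

text \<open>A coordinate of absolute value above \<open>4n\<close> would force all coordinates to
  have its sign, against the zero sum. Finiteness of the grids follows.\<close>

lemma HH_n_star_coord_bound:
  assumes "j \<in> HH_n_star n"
  shows "\<bar>j $ i\<bar> \<le> 4 * int n"
proof (rule ccontr)
  assume neg: "\<not> \<bar>j $ i\<bar> \<le> 4 * int n"
  have d: "j $ a - j $ b \<le> 4 * int n" for a b using assms by (simp add: HH_n_star_iff)
  have s: "(\<Sum>a\<in>UNIV. j $ a) = 0" using assms HH_n_star_HH HH_sum by blast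
  show False
  proof (cases "j $ i > 0")
    case True
    then have "j $ a > 0" for a using d[of i a] neg by linarith
    then have "(\<Sum>a\<in>UNIV. j $ a) > 0" by (intro sum_pos) auto
    with s show False by simp
  next
    case False
    then have "- j $ a > 0" for a using d[of a i] neg by simp
    then have "(\<Sum>a\<in>UNIV. - j $ a) > 0" by (intro sum_pos) auto
    with s show False by (simp add: sum_negf)
  qed
qed

lemma finite_HH_n_star: "finite (HH_n_star n)"
proof (rule finite_subset)
  show "HH_n_star n \<subseteq> vec_lambda ` (UNIV \<rightarrow>\<^sub>E {- (4 * int n)..4 * int n})"
  proof
    fix j assume j: "j \<in> HH_n_star n"
    have "j = vec_lambda (($) j)" by simp
    moreover have "($) j \<in> UNIV \<rightarrow>\<^sub>E {- (4 * int n)..4 * int n}"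
      using HH_n_star_coord_bound[OF j] by (auto simp: abs_le_iff minus_le_iff)
    ultimately show "j \<in> vec_lambda ` (UNIV \<rightarrow>\<^sub>E {- (4 * int n)..4 * int n})" by blast
  qed
qed (intro finite_imageI finite_PiE, auto)

lemma finite_HH_n: "finite (HH_n n)"
  using finite_HH_n_star HH_n_subset by (rule finite_subset[rotated])

text \<open>A class modulo \<open>4n\<close> times the root lattice is determined by the first three
  coordinates modulo \<open>4n\<close>, the last being fixed by the zero sum. The triples that occur
  have a common residue \<open>r\<close> modulo 4: four choices of \<open>r\<close> and
  \<open>n\<close> choices for each quotient.\<close>

lemma card_HH_n:
  assumes n: "n \<ge> 1"
  shows "card (HH_n n) = 4 * n ^ 3"
proof -
  let ?N = "4 * int n"
  define q where "q j = (j $ 0 mod ?N, j $ 1 mod ?N, j $ 2 mod ?N)" for j :: "int^4"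
  define mk where "mk = (\<lambda>(r, a, b, c). (4 * a + r, 4 * b + r, 4 * c + r :: int))"
  define P where "P = {0..<4::int} \<times> {0..<int n} \<times> {0..<int n} \<times> {0..<int n}"
  have div4: "a = a' \<and> r = r'" if "4 * a + r = 4 * a' + r'" "0 \<le> r" "r < 4" "0 \<le> r'" "r' < 4"
    for a a' r r' :: int using that by presburger
  have "inj_on mk P"
  proof (rule inj_onI)
    fix x y assume "x \<in> P" "y \<in> P" "mk x = mk y"
    moreover obtain r a b c where "x = (r, a, b, c)" by (cases x) auto
    moreover obtain r' a' b' c' where "y = (r', a', b', c')" by (cases y) auto
    ultimately show "x = y"
      using div4[of a r a' r'] div4[of b r b' r'] div4[of c r c' r'] by (simp add: mk_def P_def)
  qed
  have "inj_on q (HH_n n)"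
  proof (rule inj_onI)
    fix j k assume jk: "j \<in> HH_n n" "k \<in> HH_n n" "q j = q k"
    then have d: "?N dvd k $ 0 - j $ 0" "?N dvd k $ 1 - j $ 1" "?N dvd k $ 2 - j $ 2"
      unfolding q_def by (metis mod_eq_dvd_iff prod.inject)+
    have "k $ 3 - j $ 3 = - ((k $ 0 - j $ 0) + (k $ 1 - j $ 1) + (k $ 2 - j $ 2))"
      using HH_sum[OF HH_n_HH[OF jk(1)]] HH_sum[OF HH_n_HH[OF jk(2)]] unfolding sum_UNIV_4 by linarith
    then have "?N dvd k $ 3 - j $ 3" using d by (metis dvd_add dvd_minus_iff)
    then have "lat_eq n j k" using d unfolding lat_eq_def all_UNIV_4 by simp
    then show "j = k" using HH_n_unique n jk by blast
  qed
  moreover have "q ` HH_n n = mk ` P"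
  proof (intro equalityI subsetI)
    fix x assume "x \<in> q ` HH_n n"
    then obtain j where j: "j \<in> HH_n n" "x = q j" by auto
    define r where "r = j $ 0 mod 4"
    have r: "(j $ i mod ?N) mod 4 = r" for i
      using HH_mod[OF HH_n_HH[OF j(1)], of i 0] unfolding r_def by (simp add: mod_mod_cancel)
    have e: "j $ i mod ?N = 4 * ((j $ i mod ?N) div 4) + r" for i
      using mult_div_mod_eq[of 4 "j $ i mod ?N"] r[of i] by simp
    have b: "(j $ i mod ?N) div 4 \<in> {0..<int n}" for i
    proof -
      have "0 \<le> j $ i mod ?N" "j $ i mod ?N < ?N" using n by auto
      then show ?thesis by auto
    qed
    have "x = mk (r, (j $ 0 mod ?N) div 4, (j $ 1 mod ?N) div 4, (j $ 2 mod ?N) div 4)"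
      unfolding j(2) q_def mk_def using e by simp
    moreover have "(r, (j $ 0 mod ?N) div 4, (j $ 1 mod ?N) div 4, (j $ 2 mod ?N) div 4) \<in> P"
      unfolding P_def using b by (simp add: r_def)
    ultimately show "x \<in> mk ` P" by blast
  next
    fix x assume "x \<in> mk ` P"
    then obtain r a b c where x: "x = (4 * a + r, 4 * b + r, 4 * c + r)"
      and rg: "0 \<le> r" "r < 4" "0 \<le> a" "a < int n" "0 \<le> b" "b < int n" "0 \<le> c" "c < int n"
      by (auto simp: mk_def P_def)
    \<comment> \<open>The last coordinate is forced by the zero sum, and it is again congruent to
      \<open>r\<close> modulo 4.\<close>
    define j :: "int^4" where "j = (\<chi> i. if i = 0 then 4 * a + r else if i = 1 then 4 * b + r
      else if i = 2 then 4 * c + r else - (4 * a + 4 * b + 4 * c + 3 * r))"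
    have jc: "j $ 0 = 4 * a + r" "j $ 1 = 4 * b + r" "j $ 2 = 4 * c + r"
      "j $ 3 = 4 * (- (a + b + c + r)) + r"
      by (auto simp: j_def)
    have "(4 * x + r) mod 4 = r" for x using rg by simp
    then have "\<forall>i. j $ i mod 4 = r" unfolding all_UNIV_4 jc by blast
    then have "j \<in> HH" unfolding HH_def sum_UNIV_4 by (auto simp: jc)
    then obtain k where k: "k \<in> HH_n n" "lat_eq n j k" using HH_n_exists n by blast
    have "k $ i mod ?N = j $ i mod ?N" for i
      using k(2) unfolding lat_eq_def by (metis mod_eq_dvd_iff)
    then have "q k = q j" by (simp add: q_def)
    also have "\<dots> = x" using rg by (simp add: q_def x jc)
    finally show "x \<in> q ` HH_n n" using k(1) by blast
  qed
  ultimately have "card (HH_n n) = card (mk ` P)" by (metis card_image)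
  also have "\<dots> = card P" using \<open>inj_on mk P\<close> by (rule card_image)
  also have "\<dots> = 4 * n ^ 3" by (simp add: P_def card_cartesian_product power3_eq_cube)
  finally show ?thesis .
qed

section \<open>Characters and their sums over the grid\<close>

lemma phi_alt: "phi k t = cis (pi / 2 * (\<Sum>i\<in>UNIV. of_int (k $ i) * t $ i))"
  by (simp add: phi_def cis_conv_exp)

lemma phi_mult_cnj: "phi k t * cnj (phi l t) = phi (k - l) t"
  by (simp add: phi_alt cis_cnj cis_mult left_diff_distrib sum_subtractf right_diff_distrib)

lemma phi_0 [simp]: "phi 0 t = 1"
  by (simp add: phi_alt)

lemma phi_add: "phi k (s + t) = phi k s * phi k t"
  by (simp add: phi_alt cis_mult distrib_left sum.distrib)

lemma grid_pt_add: "grid_pt n (j + k) = grid_pt n j + grid_pt n k"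
  by (simp add: grid_pt_def vec_eq_iff add_divide_distrib)

text \<open>Writing each coordinate of \<open>m\<close> as \<open>4 * a i + r\<close>, the
  contribution of \<open>r\<close> to the phase vanishes because \<open>z\<close> sums to zero, and
  the rest is a multiple of \<open>2 * pi\<close>. The congruence condition in \<open>HH\<close>
  serves exactly this.\<close>

lemma phi_int:
  assumes "m \<in> HH" "\<And>i. t $ i = of_int (z i)" "(\<Sum>i\<in>UNIV. z i) = 0"
  shows "phi m t = 1"
proof -
  define r where "r = m $ 0 mod 4"
  define a where "a i = m $ i div 4" for i
  have m: "m $ i = 4 * a i + r" for i
    using HH_mod[OF assms(1), of i 0] unfolding r_def a_def by (metis mult_div_mod_eq)
  have "(\<Sum>i\<in>UNIV. m $ i * z i) = 4 * (\<Sum>i\<in>UNIV. a i * z i) + r * (\<Sum>i\<in>UNIV. z i)"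
    by (simp add: m distrib_right sum.distrib sum_distrib_left mult.assoc)
  also have "\<dots> = 4 * (\<Sum>i\<in>UNIV. a i * z i)" using assms(3) by simp
  finally have "(\<Sum>i\<in>UNIV. of_int (m $ i) * t $ i) = of_int (4 * (\<Sum>i\<in>UNIV. a i * z i))"
    unfolding assms(2) by (simp only: flip: of_int_mult of_int_sum)
  then have "pi / 2 * (\<Sum>i\<in>UNIV. of_int (m $ i) * t $ i) = 2 * pi * of_int (\<Sum>i\<in>UNIV. a i * z i)"
    by simp
  then show ?thesis unfolding phi_alt by (simp only: cis_multiple_2pi Ints_of_int)
qed

lemma phi_lat_eq:
  assumes "n \<ge> 1" "m \<in> HH" "j \<in> HH" "k \<in> HH" "lat_eq n j k"
  shows "phi m (grid_pt n j) = phi m (grid_pt n k)"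
proof -
  have "phi m (grid_pt n (k - j)) = 1"
  proof (rule phi_int[OF assms(2), where z = "\<lambda>i. (k $ i - j $ i) div (4 * int n)"])
    fix i
    have "(k $ i - j $ i) = ((k $ i - j $ i) div (4 * int n)) * (4 * int n)"
      using assms(5) unfolding lat_eq_def by simp
    then have "real_of_int (k $ i - j $ i) = of_int ((k $ i - j $ i) div (4 * int n)) * (4 * real n)"
      by (metis of_int_mult of_int_numeral of_int_of_nat_eq)
    then show "grid_pt n (k - j) $ i = of_int ((k $ i - j $ i) div (4 * int n))"
      using assms(1) by (simp add: grid_pt_def field_simps)
  next
    have "4 * int n * (\<Sum>i\<in>UNIV. (k $ i - j $ i) div (4 * int n)) = (\<Sum>i\<in>UNIV. k $ i - j $ i)"
      using assms(5) unfolding lat_eq_def sum_distrib_left by (intro sum.cong refl dvd_mult_div_cancel) auto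
    also have "\<dots> = 0" using HH_sum[OF assms(3)] HH_sum[OF assms(4)] by (simp add: sum_subtractf)
    finally show "(\<Sum>i\<in>UNIV. (k $ i - j $ i) div (4 * int n)) = 0" using assms(1) by simp
  qed
  then show ?thesis using phi_add[of m "grid_pt n j" "grid_pt n (k - j)"]
    by (simp flip: grid_pt_add)
qed

definition red :: "nat \<Rightarrow> int^4 \<Rightarrow> int^4" where
  "red n j = (SOME k. k \<in> HH_n n \<and> lat_eq n j k)"

lemma red:
  assumes "n \<ge> 1" "j \<in> HH"
  shows "red n j \<in> HH_n n" "lat_eq n j (red n j)"
  using someI_ex[of "\<lambda>k. k \<in> HH_n n \<and> lat_eq n j k"] HH_n_exists[OF assms]
  unfolding red_def by blast+

text \<open>Translation by \<open>v\<close> followed by reduction permutes \<open>HH_n n\<close>: it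
  is injective by uniqueness of representatives, hence surjective by finiteness. The character does
  not notice the reduction.\<close>

lemma sum_phi_shift:
  assumes n: "n \<ge> 1" and m: "m \<in> HH" and v: "v \<in> HH"
  shows "(\<Sum>j\<in>HH_n n. phi m (grid_pt n j)) = phi m (grid_pt n v) * (\<Sum>j\<in>HH_n n. phi m (grid_pt n j))"
proof -
  let ?r = "\<lambda>j. red n (v + j)"
  have H: "v + j \<in> HH" if "j \<in> HH_n n" for j using HH_add[OF v HH_n_HH[OF that]] .
  have "inj_on ?r (HH_n n)"
  proof (rule inj_onI)
    fix j k assume jk: "j \<in> HH_n n" "k \<in> HH_n n" "?r j = ?r k"
    have "lat_eq n (v + j) (v + k)"
      using red(2)[OF n H[OF jk(1)]] red(2)[OF n H[OF jk(2)]] jk(3)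
      by (metis lat_eq_sym lat_eq_trans)
    then have "lat_eq n j k" by (simp add: lat_eq_def)
    then show "j = k" using HH_n_unique n jk by blast
  qed
  moreover have "?r ` HH_n n \<subseteq> HH_n n" using red(1)[OF n H] by blast
  ultimately have bij: "bij_betw ?r (HH_n n) (HH_n n)"
    using finite_HH_n by (simp add: bij_betw_def endo_inj_surj)
  have "(\<Sum>j\<in>HH_n n. phi m (grid_pt n j)) = (\<Sum>j\<in>HH_n n. phi m (grid_pt n (?r j)))"
    using sum.reindex_bij_betw[OF bij, of "\<lambda>j. phi m (grid_pt n j)"] by simp
  also have "\<dots> = (\<Sum>j\<in>HH_n n. phi m (grid_pt n (v + j)))"
    by (intro sum.cong refl phi_lat_eq[OF n m, symmetric] H HH_n_HH[OF red(1)[OF n H]] red(2) n)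
  also have "\<dots> = phi m (grid_pt n v) * (\<Sum>j\<in>HH_n n. phi m (grid_pt n j))"
    by (simp add: grid_pt_add phi_add sum_distrib_left)
  finally show ?thesis .
qed

lemma sum_phi_eq_0:
  assumes n: "n \<ge> 1" and m: "m \<in> HH" and nz: "\<not> lat_eq n 0 m"
  shows "(\<Sum>j\<in>HH_n n. phi m (grid_pt n j)) = 0"
proof -
  obtain i where i: "\<not> 4 * int n dvd m $ i" using nz by (auto simp: lat_eq_def)
  \<comment> \<open>Pairing \<open>m\<close> with the all-ones vector gives 0, so pairing it with
    \<open>v\<close> isolates \<open>-4 * m $ i\<close>. The phase at \<open>v / (4n)\<close> is
    then trivial only if \<open>4n\<close> divides \<open>m $ i\<close>.\<close>
  define v :: "int^4" where "v = (\<chi> l. 1 - 4 * (if l = i then 1 else 0))"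
  have "v $ a mod 4 = 1" for a by (simp add: v_def)
  moreover have "(\<Sum>a\<in>UNIV. v $ a) = 0" by (simp add: v_def sum_subtractf flip: sum_distrib_left)
  ultimately have v: "v \<in> HH" by (simp add: HH_def)
  have "(\<Sum>a\<in>UNIV. m $ a * v $ a) = (\<Sum>a\<in>UNIV. m $ a) - 4 * (\<Sum>a\<in>UNIV. if a = i then m $ i else 0)"
    unfolding sum_distrib_left sum_subtractf[symmetric] by (intro sum.cong) (auto simp: v_def)
  also have "\<dots> = - 4 * m $ i" using HH_sum[OF m] by simp
  finally have s: "(\<Sum>a\<in>UNIV. m $ a * v $ a) = - 4 * m $ i" .
  have "phi m (grid_pt n v) \<noteq> 1"
  proof
    assume "phi m (grid_pt n v) = 1"
    then have "exp (\<i> * of_real (pi / 2 * (\<Sum>a\<in>UNIV. of_int (m $ a) * grid_pt n v $ a))) = 1"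
      by (simp add: phi_def)
    then obtain d :: int where d: "pi / 2 * (\<Sum>a\<in>UNIV. of_int (m $ a) * grid_pt n v $ a) = of_int (2 * d) * pi"
      unfolding exp_eq_1 by auto
    have "(\<Sum>a\<in>UNIV. of_int (m $ a) * grid_pt n v $ a) = of_int (\<Sum>a\<in>UNIV. m $ a * v $ a) / (4 * real n)"
      by (simp add: grid_pt_def sum_divide_distrib)
    then have "pi * - of_int (m $ i) = pi * (4 * real n * of_int d)"
      using d n unfolding s by (simp add: field_simps)
    then have "- of_int (m $ i) = 4 * real n * of_int d"
      by (metis mult_cancel_left pi_neq_zero)
    then have "real_of_int (- m $ i) = of_int (4 * int n * d)" by simp
    then have "- m $ i = 4 * int n * d" by (simp only: of_int_eq_iff)
    then have "4 * int n dvd m $ i" by (metis dvd_minus_iff dvd_triv_left)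
    with i show False by simp
  qed
  then show ?thesis using sum_phi_shift[OF n m v] by simp
qed

lemma sum_phi_HH_n:
  assumes n: "n \<ge> 1" and k: "k \<in> HH_n n" and l: "l \<in> HH_n n"
  shows "(\<Sum>j\<in>HH_n n. phi (k - l) (grid_pt n j)) = (if k = l then 4 * of_nat n ^ 3 else 0)"
proof (cases "k = l")
  case True
  then show ?thesis using card_HH_n[OF n] by simp
next
  case False
  then have "\<not> lat_eq n 0 (k - l)"
    using HH_n_unique[OF n l k] by (auto simp: lat_eq_def)
  then show ?thesis
    using False sum_phi_eq_0[OF n HH_diff] k l HH_n_HH by simp
qed

text \<open>Reduces all three inner products, by linearity, to single characters with frequency in
  \<open>HH\<close>.\<close>

lemma trig_space_product:
  assumes "f \<in> trig_space n" "g \<in> trig_space n"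
  obtains c d where "\<And>t. f t * cnj (g t) = (\<Sum>k\<in>HH_n n. \<Sum>l\<in>HH_n n. c k * cnj (d l) * phi (k - l) t)"
proof -
  obtain c d where "f = (\<lambda>t. \<Sum>k\<in>HH_n n. c k * phi k t)" "g = (\<lambda>t. \<Sum>k\<in>HH_n n. d k * phi k t)"
    using assms unfolding trig_space_def by auto
  then have "f t * cnj (g t) = (\<Sum>k\<in>HH_n n. \<Sum>l\<in>HH_n n. c k * cnj (d l) * phi (k - l) t)" for t
    by (simp add: sum_product algebra_simps flip: phi_mult_cnj)
  then show ?thesis by (rule that)
qed

section \<open>Boundary weights of the closed grid\<close>

lemma weight_interior:
  assumes "\<And>i l. k $ i - k $ l < 4 * int n"
  shows "weight n k = 1"
proof -
  have "Max (range (($) k)) \<in> range (($) k)" "Min (range (($) k)) \<in> range (($) k)"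
    by (auto intro!: Max_in Min_in)
  then have "Max (range (($) k)) - Min (range (($) k)) < 4 * int n"
    using assms by force
  then show ?thesis by (simp add: weight_def Let_def)
qed

text \<open>Names the extreme values explicitly, since all members of a boundary class share
  them.\<close>

lemma weight_boundary:
  assumes "\<And>i. b \<le> k $ i" "\<And>i. k $ i \<le> b + 4 * int n" "k $ i0 = b" "k $ i1 = b + 4 * int n"
  shows "weight n k = 1 / real ((card {i. k $ i = b + 4 * int n} + card {i. k $ i = b}) choose card {i. k $ i = b + 4 * int n})"
proof -
  have "b + 4 * int n \<in> range (($) k)" "b \<in> range (($) k)" using assms(3,4) by (metis rangeI)+
  then have "Max (range (($) k)) = b + 4 * int n" "Min (range (($) k)) = b"
    using assms(1,2) by (auto intro!: Max_eqI Min_eqI)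
  then show ?thesis by (simp add: weight_def Let_def)
qed

lemma sum_weight_class:
  assumes n: "n \<ge> 1" and h: "h \<in> HH_n n"
  shows "(\<Sum>j\<in>{j \<in> HH_n_star n. lat_eq n h j}. weight n j) = 1"
proof -
  let ?F = "{j \<in> HH_n_star n. lat_eq n h j}"
  have hs: "h \<in> HH_n_star n" using h HH_n_subset by blast
  \<comment> \<open>The next two facts describe how another member \<open>j\<close> of the class can
    differ from \<open>h\<close>: a coordinate moves by exactly \<open>4n\<close>, and only if
    \<open>h\<close> attains the value it moves to.\<close>
  have hd: "h $ i - h $ l \<le> 4 * int n" for i l using hs by (simp add: HH_n_star_iff)
  have up: "j $ i = h $ i + 4 * int n" "\<exists>l. h $ l = h $ i + 4 * int n"
    if "j \<in> ?F" "j $ i > h $ i" for i j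
  proof -
    have *: "sum (($) h) UNIV = sum (($) j) UNIV"
      using HH_sum[OF HH_n_star_HH[OF hs]] HH_sum[of j] that HH_n_star_HH by auto
    note step = closed_tile_step[OF _ * lat_eq_dvdD[of n h j] hd _ that(2)]
    show "j $ i = h $ i + 4 * int n" by (rule step) (use that n in \<open>auto simp: HH_n_star_iff\<close>)
    have "\<exists>l. j $ l < h $ l \<and> h $ l - h $ i = 4 * int n \<and> j $ i - j $ l = 4 * int n"
      by (rule step) (use that n in \<open>auto simp: HH_n_star_iff\<close>)
    then show "\<exists>l. h $ l = h $ i + 4 * int n" by (auto simp: diff_eq_eq add.commute)
  qed
  \<comment> \<open>The downward case is the upward one for the negated vectors.\<close>
  have dn: "j $ i = h $ i - 4 * int n" "\<exists>l. h $ l = h $ i - 4 * int n"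
    if "j \<in> ?F" "j $ i < h $ i" for i j
  proof -
    have *: "sum (\<lambda>i. - h $ i) UNIV = sum (\<lambda>i. - j $ i) UNIV"
      using HH_sum[OF HH_n_star_HH[OF hs]] HH_sum[of j] that HH_n_star_HH by (auto simp: sum_negf)
    have lat: "\<exists>d::int. - j $ i - - h $ i = 4 * int n * of_int d" for i
      using lat_eq_dvdD[OF lat_eq_sym[of n h j], of i] that by auto
    have hd': "- h $ i - - h $ l \<le> 4 * int n" for i l using hd[of l i] by simp
    have "- j $ i > - h $ i" using that by simp
    note step = closed_tile_step[OF _ * lat hd' _ this]
    have "- j $ i = - h $ i + 4 * int n" by (rule step) (use that n in \<open>auto simp: HH_n_star_iff\<close>)
    then show "j $ i = h $ i - 4 * int n" by simp
    have "\<exists>l. - j $ l < - h $ l \<and> - h $ l - - h $ i = 4 * int n \<and> - j $ i - - j $ l = 4 * int n"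
      by (rule step) (use that n in \<open>auto simp: HH_n_star_iff\<close>)
    then show "\<exists>l. h $ l = h $ i - 4 * int n" by (auto simp: algebra_simps)
  qed
  show ?thesis
  proof (cases "\<forall>i l. h $ i - h $ l < 4 * int n")
    case True
    have "?F = {h}"
    proof (intro equalityI subsetI)
      fix j assume j: "j \<in> ?F"
      have "j $ i = h $ i" for i
      proof (rule linorder_cases)
        assume "j $ i < h $ i"
        then obtain l where "h $ l = h $ i - 4 * int n" using dn(2) j by blast
        then have "h $ i - h $ l = 4 * int n" by simp
        with True show ?thesis by (metis order_less_irrefl)
      next
        assume "h $ i < j $ i"
        then obtain l where "h $ l = h $ i + 4 * int n" using up(2) j by blast
        then have "h $ l - h $ i = 4 * int n" by simp
        with True show ?thesis by (metis order_less_irrefl)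
      qed
      then show "j \<in> {h}" by (simp add: vec_eq_iff)
    qed (use hs in simp)
    then show ?thesis using weight_interior True by simp
  next
    case False
    then obtain i1 i0 where "h $ i1 - h $ i0 \<ge> 4 * int n" by (auto simp: not_less)
    with hd[of i1 i0] have i01: "h $ i1 = h $ i0 + 4 * int n" by simp
    define b where "b = h $ i0"
    define B where "B = b + 4 * int n"
    have bB: "b < B" using n by (simp add: B_def)
    have hb: "b \<le> h $ i" "h $ i \<le> B" for i
      using hd[of i i0] hd[of i1 i] i01 by (simp_all add: b_def B_def)
    define T where "T = {i. h $ i = B \<or> h $ i = b}"
    define p where "p = card {i. h $ i = B}"
    define q where "q = card {i. h $ i = b}"
    have T_Un: "T = {i. h $ i = B} \<union> {i. h $ i = b}" by (auto simp: T_def)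
    have cT: "card T = p + q" unfolding T_Un p_def q_def by (rule card_Un_disjoint) (use bB in auto)
    have "i1 \<in> {i. h $ i = B}" "i0 \<in> {i. h $ i = b}" using i01 by (auto simp: b_def B_def)
    then have pq: "p > 0" "q > 0" unfolding p_def q_def by (auto simp: card_gt_0_iff)
    \<comment> \<open>\<open>T\<close> holds the extremal positions of \<open>h\<close>. Class
      members correspond to the choices of the set \<open>S\<close> of maximal positions inside
      \<open>T\<close>; all other coordinates are those of \<open>h\<close>.\<close>
    define mk where "mk S = (\<chi> i. if i \<in> T then if i \<in> S then B else b else h $ i)" for S
    have split: "(\<Sum>i\<in>UNIV. x i) = (\<Sum>i\<in>T. x i) + (\<Sum>i\<in>-T. x i)" for x :: "4 \<Rightarrow> int"
      by (metis add.commute finite Compl_eq_Diff_UNIV subset_UNIV sum.subset_diff)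
    have sumT: "(\<Sum>i\<in>T. if i \<in> S then B else b) = int (card S) * B + (int (p + q) - int (card S)) * b"
      if "S \<subseteq> T" for S
    proof -
      have "(\<Sum>i\<in>T. if i \<in> S then B else b) = int (card (T \<inter> S)) * B + int (card (T - S)) * b"
        by (simp add: sum.If_cases Diff_eq)
      moreover have "T \<inter> S = S" using that by auto
      moreover have "card (T - S) = p + q - card S" "card S \<le> p + q"
        using that cT by (auto simp: card_Diff_subset finite_subset card_mono simp flip: cT)
      ultimately show ?thesis by (simp add: of_nat_diff)
    qed
    have hT: "(\<Sum>i\<in>T. h $ i) = int p * B + (int (p + q) - int p) * b"
    proof -
      have "(\<Sum>i\<in>T. h $ i) = (\<Sum>i\<in>T. if i \<in> {i. h $ i = B} then B else b)"
        by (rule sum.cong) (auto simp: T_def)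
      also have "\<dots> = int p * B + (int (p + q) - int p) * b"
        unfolding p_def by (subst sumT) (auto simp: T_def p_def)
      finally show ?thesis .
    qed
    have form: "mk {i. j $ i = B} = j" "{i. j $ i = B} \<subseteq> T" "card {i. j $ i = B} = p" "card {i. j $ i = b} = q"
      "\<And>i. b \<le> j $ i \<and> j $ i \<le> B"
      if j: "j \<in> ?F" for j
    proof -
      have c: "j $ i = h $ i \<or> h $ i = b \<and> j $ i = B \<or> h $ i = B \<and> j $ i = b" for i
      proof (cases "j $ i" "h $ i" rule: linorder_cases)
        case greater
        with up j obtain l where "j $ i = h $ i + 4 * int n" "h $ l = h $ i + 4 * int n" by blast
        then show ?thesis using hb[of i] hb(2)[of l] unfolding B_def by simp
      next
        case less
        with dn j obtain l where "j $ i = h $ i - 4 * int n" "h $ l = h $ i - 4 * int n" by blast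
        then show ?thesis using hb[of i] hb(1)[of l] unfolding B_def by simp
      qed simp
      show sub: "{i. j $ i = B} \<subseteq> T" using c by (force simp: T_def)
      show mk: "mk {i. j $ i = B} = j"
        unfolding mk_def vec_eq_iff using c by (force simp: T_def)
      show "\<And>i. b \<le> j $ i \<and> j $ i \<le> B" using c hb bB by (metis order.refl less_imp_le)
      let ?S = "{i. j $ i = B}"
      have "(\<Sum>i\<in>UNIV. j $ i) = (\<Sum>i\<in>UNIV. mk ?S $ i)" unfolding mk ..
      also have "\<dots> = (\<Sum>i\<in>T. if i \<in> ?S then B else b) + (\<Sum>i\<in>-T. h $ i)"
        unfolding split by (simp add: mk_def)
      also have "\<dots> = int (card ?S) * B + (int (p + q) - int (card ?S)) * b + (\<Sum>i\<in>-T. h $ i)"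
        using sumT[OF sub] by simp
      \<comment> \<open>Both vectors sum to zero and agree off \<open>T\<close>, so their sums over
        \<open>T\<close> agree; as \<open>b < B\<close>, this fixes the number of maximal
        positions.\<close>
      finally have "int (card ?S) * B + (int (p + q) - int (card ?S)) * b = int p * B + (int (p + q) - int p) * b"
        using HH_sum[OF HH_n_HH[OF h]] HH_sum[OF HH_n_star_HH[of j n]] j hT split[of "($) h"] by simp
      then have "(int (card ?S) - int p) * (B - b) = 0" by (simp add: algebra_simps)
      then show cp: "card ?S = p" using bB by simp
      have "T = ?S \<union> {i. j $ i = b}" using c by (force simp: T_def)
      then have "card T = card ?S + card {i. j $ i = b}"
        using bB by (metis (mono_tags, lifting) card_Un_disjoint finite disjoint_iff mem_Collect_eq order_less_irrefl)
      then show "card {i. j $ i = b} = q" using cT cp by simp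
    qed
    have mkF: "mk S \<in> ?F" "{i. mk S $ i = B} = S" if S: "S \<subseteq> T" "card S = p" for S
    proof -
      show "{i. mk S $ i = B} = S" using S(1) bB by (auto simp: mk_def T_def split: if_splits)
      have "(\<Sum>i\<in>UNIV. mk S $ i) = (\<Sum>i\<in>T. if i \<in> S then B else b) + (\<Sum>i\<in>-T. h $ i)"
        unfolding split by (simp add: mk_def)
      also have "\<dots> = (\<Sum>i\<in>UNIV. h $ i)" using sumT[OF S(1)] S(2) hT split[of "($) h"] by simp
      finally have s: "(\<Sum>i\<in>UNIV. mk S $ i) = 0" using HH_sum[OF HH_n_HH[OF h]] by simp
      \<comment> \<open>No new values arise, so the congruence modulo 4 and the bound on differences
        are inherited from \<open>h\<close>.\<close>
      have co: "\<exists>l. mk S $ i = h $ l" for i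
      proof -
        have "B = h $ i1" "b = h $ i0" using i01 by (simp_all add: b_def B_def)
        then show ?thesis unfolding mk_def by (cases "i \<in> T"; cases "i \<in> S") auto
      qed
      have "mk S \<in> HH" unfolding HH_def using s co HH_mod[OF HH_n_HH[OF h]] by (simp, metis)
      moreover have "mk S $ i - mk S $ l \<le> 4 * int n" for i l using co[of i] co[of l] hd by auto
      moreover have "lat_eq n h (mk S)" unfolding lat_eq_def by (auto simp: mk_def T_def B_def)
      ultimately show "mk S \<in> ?F" by (simp add: HH_n_star_iff)
    qed
    have "bij_betw (\<lambda>j. {i. j $ i = B}) ?F {S. S \<subseteq> T \<and> card S = p}"
      by (rule bij_betw_byWitness[where f' = mk]) (use form mkF in \<open>blast+\<close>)
    then have "card ?F = (p + q) choose p"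
      using n_subsets[of T p] cT by (simp add: bij_betw_same_card)
    moreover have "weight n j = 1 / real ((p + q) choose p)" if j: "j \<in> ?F" for j
    proof -
      have "{i. j $ i = B} \<noteq> {}" "{i. j $ i = b} \<noteq> {}" using form(3,4)[OF j] pq by force+
      then show ?thesis
        using weight_boundary[of b j n] form(3-5)[OF j] unfolding B_def by blast
    qed
    ultimately show ?thesis by (simp add: binomial_eq_0_iff)
  qed
qed

text \<open>The closed grid is grouped by reduction into \<open>HH_n n\<close>; on each group
  \<open>F\<close> is constant and the weights add up to 1.\<close>

lemma sum_HH_n_star_weight:
  fixes F :: "int^4 \<Rightarrow> complex"
  assumes n: "n \<ge> 1" and F: "\<And>j k. j \<in> HH \<Longrightarrow> k \<in> HH \<Longrightarrow> lat_eq n j k \<Longrightarrow> F j = F k"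
  shows "(\<Sum>j\<in>HH_n_star n. of_real (weight n j) * F j) = (\<Sum>h\<in>HH_n n. F h)"
proof -
  let ?f = "\<lambda>j. of_real (weight n j) * F j"
  have "(\<Sum>j\<in>HH_n_star n. ?f j) = (\<Sum>h\<in>HH_n n. \<Sum>j\<in>{j \<in> HH_n_star n. red n j = h}. ?f j)"
    by (rule sum.group[symmetric]) (use finite_HH_n_star finite_HH_n red(1)[OF n HH_n_star_HH] in auto)
  also have "\<dots> = (\<Sum>h\<in>HH_n n. F h)"
  proof (rule sum.cong)
    fix h assume h: "h \<in> HH_n n"
    have "{j \<in> HH_n_star n. red n j = h} = {j \<in> HH_n_star n. lat_eq n h j}"
      using red[OF n HH_n_star_HH] h HH_n_unique[OF n] lat_eq_sym lat_eq_trans by blast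
    then have "(\<Sum>j\<in>{j \<in> HH_n_star n. red n j = h}. ?f j) = (\<Sum>j\<in>{j \<in> HH_n_star n. lat_eq n h j}. of_real (weight n j) * F h)"
      using F[OF HH_n_HH[OF h] HH_n_star_HH] by (auto intro!: sum.cong)
    also have "\<dots> = of_real (\<Sum>j\<in>{j \<in> HH_n_star n. lat_eq n h j}. weight n j) * F h"
      by (simp add: sum_distrib_right)
    finally show "(\<Sum>j\<in>{j \<in> HH_n_star n. red n j = h}. ?f j) = F h"
      unfolding sum_weight_class[OF n h] by simp
  qed simp
  finally show ?thesis .
qed

section \<open>Integrals of periodic functions over fundamental domains\<close>

lemma integral_lborel_shift:
  fixes f :: "'a::euclidean_space \<Rightarrow> 'b::{banach, second_countable_topology}"
  assumes "f \<in> borel_measurable borel"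
  shows "(\<integral>x. f (z + x) \<partial>lborel) = (\<integral>x. f x \<partial>lborel)"
proof -
  have "(\<integral>x. f x \<partial>lborel) = (\<integral>x. f x \<partial>distr lborel borel ((+) z))"
    by (simp only: lborel_distr_plus)
  also have "\<dots> = (\<integral>x. f (z + x) \<partial>lborel)"
    using assms by (intro integral_distr) auto
  finally show ?thesis ..
qed

lemma set_integrable_bounded_continuous:
  fixes F :: "'a::euclidean_space \<Rightarrow> 'b::{banach, second_countable_topology}"
  assumes "D \<in> sets borel" "bounded D" "continuous_on UNIV F"
  shows "set_integrable lborel D F"
proof -
  obtain r where r: "\<forall>p\<in>D. norm p \<le> r" using assms(2) unfolding bounded_iff by blast
  have "set_integrable lborel (cball 0 r) F"
    unfolding set_integrable_def
    by (rule borel_integrable_compact[OF compact_cball continuous_on_subset[OF assms(3)]]) simp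
  then show ?thesis
  proof (rule set_integrable_subset)
    show "D \<subseteq> cball 0 r" using r by auto
    show "D \<in> sets lborel" using assms(1) by simp
  qed
qed

text \<open>A fundamental domain in the exact sense, not merely up to null sets; half-open
  boundaries make this possible.\<close>

definition tile :: "'a::ab_group_add set \<Rightarrow> 'a set \<Rightarrow> bool" where
  "tile L D \<longleftrightarrow> (\<forall>p. \<exists>!z. z \<in> L \<and> z + p \<in> D)"

lemma tile_translate:
  assumes "tile L D"
  shows "tile L ((+) v ` D)"
  unfolding tile_def
proof
  fix p
  have "z + p \<in> (+) v ` D \<longleftrightarrow> z + (p - v) \<in> D" for z
    by (auto simp: image_iff add_diff_eq eq_diff_eq add.commute intro!: bexI[of _ "z + p - v"])
  then show "\<exists>!z. z \<in> L \<and> z + p \<in> (+) v ` D"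
    using assms unfolding tile_def by simp
qed

lemma sum_indicator_tile:
  assumes "tile L D" "finite Z" "Z \<subseteq> L" "\<And>z. z \<in> L \<Longrightarrow> z + p \<in> D \<Longrightarrow> z \<in> Z"
  shows "(\<Sum>z\<in>Z. indicator D (z + p)) = (1::real)"
proof -
  obtain w where w: "w \<in> L" "w + p \<in> D" "\<And>z. z \<in> L \<Longrightarrow> z + p \<in> D \<Longrightarrow> z = w"
    using assms(1) unfolding tile_def by metis
  have "indicator D (z + p) = (if z = w then 1 else (0::real))" if "z \<in> Z" for z
  proof (cases "z = w")
    case False
    then have "z + p \<notin> D" using w(3) that assms(3) by blast
    with False show ?thesis by simp
  qed (simp add: w(2))
  then have "(\<Sum>z\<in>Z. indicator D (z + p)) = (\<Sum>z\<in>Z. if z = w then 1 else (0::real))"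
    by (rule sum.cong[OF refl])
  also have "\<dots> = 1" using assms(2) assms(4)[OF w(1,2)] by simp
  finally show ?thesis .
qed

text \<open>Unfolding: \<open>D\<close> is cut along the translates of \<open>E\<close>, each piece
  is moved into \<open>E\<close> by its lattice vector without changing \<open>F\<close>, and the
  moved pieces fill \<open>E\<close> exactly once.\<close>

lemma periodic_integral_tile_eq:
  fixes F :: "'a::euclidean_space \<Rightarrow> complex"
  assumes D: "tile L D" "D \<in> sets borel" "bounded D"
    and E: "tile L E" "E \<in> sets borel" "bounded E"
    and L: "\<And>z. z \<in> L \<Longrightarrow> - z \<in> L" "\<And>r. finite (L \<inter> cball 0 r)"
    and F: "continuous_on UNIV F" "\<And>z p. z \<in> L \<Longrightarrow> F (z + p) = F p"
  shows "(LINT p:D|lborel. F p) = (LINT p:E|lborel. F p)"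
proof -
  obtain r1 where r1: "\<And>p. p \<in> D \<Longrightarrow> norm p \<le> r1" using D(3) unfolding bounded_iff by blast
  obtain r2 where r2: "\<And>p. p \<in> E \<Longrightarrow> norm p \<le> r2" using E(3) unfolding bounded_iff by blast
  \<comment> \<open>Only lattice vectors joining a point of one domain to a point of the other
    matter. Their norm is at most \<open>r1 + r2\<close>, so finite sums suffice.\<close>
  define Z where "Z = L \<inter> cball 0 (r1 + r2)"
  have Z: "finite Z" "Z \<subseteq> L" using L(2) by (auto simp: Z_def)
  have Zm: "- z \<in> Z" if "z \<in> Z" for z using that L(1) by (auto simp: Z_def)
  have inZ: "z \<in> Z" if "z \<in> L" "p \<in> E" "z + p \<in> D" for z p
  proof -
    have "norm z \<le> norm (z + p) + norm p" by (metis add_diff_cancel_right' norm_triangle_ineq4)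
    with r1[OF that(3)] r2[OF that(2)] that(1) show ?thesis by (auto simp: Z_def)
  qed
  have inZ': "z \<in> Z" if "z \<in> L" "p \<in> D" "z + p \<in> E" for z p
  proof -
    have "- z \<in> Z" by (rule inZ[OF L(1)[OF that(1)] that(3)]) (use that in simp)
    then show ?thesis using Zm by fastforce
  qed
  have Fm [measurable]: "F \<in> borel_measurable borel" using F(1) by (rule borel_measurable_continuous_onI)
  note D(2)[measurable] E(2)[measurable]
  let ?G = "\<lambda>z p. indicator E (z + p) *\<^sub>R (indicator D p *\<^sub>R F p)"
  let ?H = "\<lambda>z p. indicator D (z + p) *\<^sub>R (indicator E p *\<^sub>R F p)"
  have int: "integrable lborel (\<lambda>p. indicator B (z + p) *\<^sub>R (indicator A p *\<^sub>R F p))"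
    if A: "A \<in> sets borel" "bounded A" and B: "B \<in> sets borel" for A B z
  proof -
    note A(1)[measurable] B[measurable]
    have "integrable lborel (\<lambda>p. indicator {p. z + p \<in> B} p *\<^sub>R (indicator A p *\<^sub>R F p))"
    proof (rule integrable_mult_indicator)
      show "{p. z + p \<in> B} \<in> sets lborel" by measurable
      show "integrable lborel (\<lambda>p. indicator A p *\<^sub>R F p)"
        using set_integrable_bounded_continuous[OF A F(1)] by (simp add: set_integrable_def)
    qed
    then show ?thesis by (simp add: indicator_def)
  qed
  have "(LINT p:D|lborel. F p) = (\<integral>p. (\<Sum>z\<in>Z. ?G z p) \<partial>lborel)"
    unfolding set_lebesgue_integral_def
  proof (intro Bochner_Integration.integral_cong refl)
    fix p
    show "indicator D p *\<^sub>R F p = (\<Sum>z\<in>Z. ?G z p)"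
    proof (cases "p \<in> D")
      case True
      then show ?thesis
        using sum_indicator_tile[OF E(1) Z, of p] inZ' by (simp flip: scaleR_left.sum)
    qed simp
  qed
  also have "\<dots> = (\<Sum>z\<in>Z. \<integral>p. ?G z p \<partial>lborel)"
    by (intro Bochner_Integration.integral_sum int D E)
  \<comment> \<open>Substituting \<open>z + p\<close> for \<open>p\<close> turns the integrand
    \<open>?H (- z)\<close> into \<open>?G z\<close>, by periodicity of \<open>F\<close>. The sign
    disappears next because \<open>Z\<close> is symmetric.\<close>
  also have "\<dots> = (\<Sum>z\<in>Z. \<integral>p. ?H (- z) p \<partial>lborel)"
  proof (rule sum.cong)
    fix z assume z: "z \<in> Z"
    have "(\<integral>p. ?H (- z) p \<partial>lborel) = (\<integral>p. ?H (- z) (z + p) \<partial>lborel)"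
      by (rule integral_lborel_shift[symmetric]) measurable
    also have "\<dots> = (\<integral>p. ?G z p \<partial>lborel)"
      using F(2)[of z] z Z(2) by (intro Bochner_Integration.integral_cong refl) (auto simp: indicator_def)
    finally show "(\<integral>p. ?G z p \<partial>lborel) = (\<integral>p. ?H (- z) p \<partial>lborel)" ..
  qed simp
  also have "\<dots> = (\<Sum>z\<in>Z. \<integral>p. ?H z p \<partial>lborel)"
    by (rule sum.reindex_bij_witness[where i = uminus and j = uminus]) (use Zm in auto)
  also have "\<dots> = (\<integral>p. (\<Sum>z\<in>Z. ?H z p) \<partial>lborel)"
    by (intro Bochner_Integration.integral_sum[symmetric] int D E)
  also have "\<dots> = (LINT p:E|lborel. F p)"
    unfolding set_lebesgue_integral_def
  proof (intro Bochner_Integration.integral_cong refl)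
    fix p
    show "(\<Sum>z\<in>Z. ?H z p) = indicator E p *\<^sub>R F p"
    proof (cases "p \<in> E")
      case True
      then show ?thesis
        using sum_indicator_tile[OF D(1) Z, of p] inZ by (simp flip: scaleR_left.sum)
    qed simp
  qed
  finally show ?thesis .
qed

section \<open>The domain \<open>Omega_H\<close> in three coordinates\<close>

text \<open>The root lattice seen through \<open>embH\<close>: the first three coordinates of a
  zero-sum integer vector are arbitrary integers.\<close>

definition Z3 :: "(real \<times> real \<times> real) set" where
  "Z3 = \<int> \<times> \<int> \<times> \<int>"

lemma Z3_uminus: "z \<in> Z3 \<Longrightarrow> - z \<in> Z3"
  by (auto simp: Z3_def)

lemma finite_Z3_cball: "finite (Z3 \<inter> cball 0 r)"
proof (rule finite_subset)
  let ?I = "{x::real. x \<in> \<int> \<and> \<bar>x\<bar> \<le> r}"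
  show "Z3 \<inter> cball 0 r \<subseteq> ?I \<times> ?I \<times> ?I"
  proof
    fix z assume "z \<in> Z3 \<inter> cball 0 r"
    then obtain a b c where z: "z = (a, b, c)" "a \<in> \<int>" "b \<in> \<int>" "c \<in> \<int>" "norm z \<le> r"
      by (auto simp: Z3_def)
    have "\<bar>a\<bar> \<le> r" using z norm_fst_le[of a "(b, c)"] by simp
    moreover have "norm (b, c) \<le> r" using z norm_snd_le[of "(b, c)" a] by simp
    then have "\<bar>b\<bar> \<le> r" "\<bar>c\<bar> \<le> r" using norm_fst_le[of b c] norm_snd_le[of c b] by simp_all
    ultimately show "z \<in> ?I \<times> ?I \<times> ?I" using z by simp
  qed
qed (intro finite_cartesian_product finite_abs_int_segment)

text \<open>A tile of obvious volume, from which the volume of \<open>Omega3\<close> is read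
  off.\<close>

lemma tile_cube: "tile Z3 ({0..<1} \<times> {0..<1} \<times> {0..<1})"
  unfolding tile_def
proof
  have 1: "\<exists>!a. a \<in> \<int> \<and> 0 \<le> a + x \<and> a + x < 1" for x :: real
  proof (rule ex1I[of _ "of_int (- \<lfloor>x\<rfloor>)"])
    fix a assume "a \<in> \<int> \<and> 0 \<le> a + x \<and> a + x < 1"
    then obtain d where "a = of_int d" "0 \<le> of_int d + x" "of_int d + x < 1" by (auto elim: Ints_cases)
    then have "\<lfloor>x\<rfloor> = - d" by linarith
    then show "a = of_int (- \<lfloor>x\<rfloor>)" using \<open>a = of_int d\<close> by simp
  qed (simp, linarith)
  fix p :: "real \<times> real \<times> real"
  obtain x y z where p: "p = (x, y, z)" by (cases p) auto
  obtain a where a: "a \<in> \<int>" "0 \<le> a + x" "a + x < 1"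
    "\<And>a'. a' \<in> \<int> \<Longrightarrow> 0 \<le> a' + x \<Longrightarrow> a' + x < 1 \<Longrightarrow> a' = a"
    using 1[of x] unfolding Ex1_def by blast
  obtain b where b: "b \<in> \<int>" "0 \<le> b + y" "b + y < 1"
    "\<And>a'. a' \<in> \<int> \<Longrightarrow> 0 \<le> a' + y \<Longrightarrow> a' + y < 1 \<Longrightarrow> a' = b"
    using 1[of y] unfolding Ex1_def by blast
  obtain c where c: "c \<in> \<int>" "0 \<le> c + z" "c + z < 1"
    "\<And>a'. a' \<in> \<int> \<Longrightarrow> 0 \<le> a' + z \<Longrightarrow> a' + z < 1 \<Longrightarrow> a' = c"
    using 1[of z] unfolding Ex1_def by blast
  show "\<exists>!w. w \<in> Z3 \<and> w + p \<in> {0..<1} \<times> {0..<1} \<times> {0..<1}"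
  proof (rule ex1I[of _ "(a, b, c)"])
    fix w assume w: "w \<in> Z3 \<and> w + p \<in> {0..<1} \<times> {0..<1} \<times> {0..<1}"
    obtain a' b' c' where w': "w = (a', b', c')" by (cases w) auto
    have "a' = a" by (rule a(4)) (use w in \<open>auto simp: w' p Z3_def\<close>)
    moreover have "b' = b" by (rule b(4)) (use w in \<open>auto simp: w' p Z3_def\<close>)
    moreover have "c' = c" by (rule c(4)) (use w in \<open>auto simp: w' p Z3_def\<close>)
    ultimately show "w = (a, b, c)" using w' by simp
  qed (use a(1-3) b(1-3) c(1-3) in \<open>simp add: p Z3_def\<close>)
qed

lemma embH_nth [simp]:
  "embH p $ 0 = fst p" "embH p $ 1 = fst (snd p)" "embH p $ 2 = snd (snd p)"
  "embH p $ 3 = - (fst p + fst (snd p) + snd (snd p))"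
  by (simp_all add: embH_def)

lemma embH_add: "embH (p + q) = embH p + embH q"
  by (simp add: vec_eq_iff_4)

lemma embH_RH: "embH p \<in> RH"
  by (simp add: RH_def sum_UNIV_4)

lemma embH_surj: "t \<in> RH \<Longrightarrow> embH (t $ 0, t $ 1, t $ 2) = t"
  by (simp add: vec_eq_iff_4 RH_def sum_UNIV_4)

lemma continuous_embH_nth: "continuous_on UNIV (\<lambda>p. embH p $ i)"
proof -
  have "\<forall>i. continuous_on UNIV (\<lambda>p. embH p $ i)"
    unfolding all_UNIV_4 by (auto intro!: continuous_intros)
  then show ?thesis ..
qed

definition Omega3 :: "(real \<times> real \<times> real) set" where
  "Omega3 = {p. embH p \<in> Omega_H}"

lemma Omega3_iff: "p \<in> Omega3 \<longleftrightarrow>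
  (\<forall>i j. i < j \<longrightarrow> -1 < embH p $ i - embH p $ j \<and> embH p $ i - embH p $ j \<le> 1)"
  by (simp add: Omega3_def Omega_H_def embH_RH)

lemma Omega3_borel: "Omega3 \<in> sets borel"
proof -
  have "Omega3 = (\<Inter>i. \<Inter>j\<in>{j. i < j}. {p. -1 < embH p $ i - embH p $ j} \<inter> {p. embH p $ i - embH p $ j \<le> 1})"
    by (auto simp: Omega3_iff)
  also have "\<dots> = (\<Inter>(i, j)\<in>{(i, j). i < j}. {p. -1 < embH p $ i - embH p $ j} \<inter> {p. embH p $ i - embH p $ j \<le> 1})"
    by auto
  also have "\<dots> \<in> sets borel"
  proof (rule sets.countable_INT'')
    have "{p. -1 < embH p $ i - embH p $ j} \<in> sets borel" for i j
      by (intro borel_open open_Collect_less continuous_intros continuous_embH_nth)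
    moreover have "{p. embH p $ i - embH p $ j \<le> 1} \<in> sets borel" for i j
      by (intro borel_closed closed_Collect_le continuous_intros continuous_embH_nth)
    ultimately show "(case x of (i, j) \<Rightarrow> {p. -1 < embH p $ i - embH p $ j} \<inter> {p. embH p $ i - embH p $ j \<le> 1}) \<in> sets borel" for x
      by (cases x) auto
  qed auto
  finally show ?thesis .
qed

lemma Omega3_bounded: "bounded Omega3"
proof -
  have "norm p \<le> 3" if "p \<in> Omega3" for p
  proof -
    obtain x y z where p: "p = (x, y, z)" by (cases p) auto
    have d: "embH p $ i - embH p $ j \<le> 1" for i j
      using that unfolding Omega3_iff by (cases i j rule: linorder_cases) force+
    \<comment> \<open>By the zero sum, four times a coordinate is the sum of its differences to the
      other three.\<close>
    have "\<bar>x\<bar> \<le> 1" "\<bar>y\<bar> \<le> 1" "\<bar>z\<bar> \<le> 1"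
      using d[of 0 1] d[of 0 2] d[of 0 3] d[of 1 0] d[of 1 2] d[of 1 3] d[of 2 0] d[of 2 1] d[of 2 3]
        d[of 3 0] d[of 3 1] d[of 3 2] unfolding p embH_nth fst_conv snd_conv by linarith+
    then show ?thesis
      unfolding p using norm_Pair_le[of x "(y, z)"] norm_Pair_le[of y z] by simp
  qed
  then show ?thesis unfolding bounded_iff by blast
qed

lemma Z3_embH:
  assumes "z \<in> Z3"
  obtains w :: "4 \<Rightarrow> int" where "\<And>i. embH z $ i = of_int (w i)" "(\<Sum>i\<in>UNIV. w i) = 0"
proof -
  obtain a b c where z: "z = (of_int a, of_int b, of_int c)"
    using assms by (auto simp: Z3_def elim!: Ints_cases)
  define w where "w i = (if i = 0 then a else if i = 1 then b else if i = 2 then c else - (a + b + c))" for i :: 4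
  have "embH z $ i = of_int (w i)" for i by (simp add: embH_def z w_def)
  moreover have "(\<Sum>i\<in>UNIV. w i) = 0" by (simp add: sum_UNIV_4 w_def)
  ultimately show ?thesis by (rule that)
qed

lemma tile_Omega3: "tile Z3 Omega3"
  unfolding tile_def
proof
  fix p
  have s: "(\<Sum>i\<in>UNIV. embH q $ i) = 0" for q using embH_RH by (simp add: RH_def)
  obtain w :: "4 \<Rightarrow> int" where w: "(\<Sum>i\<in>UNIV. w i) = 0"
    "\<And>i j. i < j \<Longrightarrow> -1 < (embH p $ i + of_int (w i)) - (embH p $ j + of_int (w j)) \<and>
      (embH p $ i + of_int (w i)) - (embH p $ j + of_int (w j)) \<le> 1"
    using tile_exists[OF s[of p]] by blast
  \<comment> \<open>Dropping the last coordinate loses nothing: the zero sum of \<open>w\<close>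
    makes \<open>embH z\<close> recover it.\<close>
  define z where "z = (real_of_int (w 0), real_of_int (w 1), real_of_int (w 2))"
  have w3: "real_of_int (w 3) = - (of_int (w 0) + of_int (w 1) + of_int (w 2))"
    using w(1) unfolding sum_UNIV_4 by linarith
  have "embH z = (\<chi> i. of_int (w i))" by (simp add: vec_eq_iff_4 z_def w3)
  then have "z + p \<in> Omega3" using w(2) by (simp add: Omega3_iff embH_add add.commute)
  moreover have "z \<in> Z3" by (simp add: z_def Z3_def)
  moreover have "z1 = z2" if z: "z1 \<in> Z3" "z1 + p \<in> Omega3" "z2 \<in> Z3" "z2 + p \<in> Omega3" for z1 z2
  proof -
    obtain w1 where w1: "\<And>i. embH z1 $ i = of_int (w1 i)" using Z3_embH[OF z(1)] by blast
    obtain w2 where w2: "\<And>i. embH z2 $ i = of_int (w2 i)" using Z3_embH[OF z(3)] by blast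
    have "($) (embH (z1 + p)) = ($) (embH (z2 + p))"
    proof (rule tile_unique[of 1])
      fix i
      have "embH (z2 + p) $ i - embH (z1 + p) $ i = 1 * of_int (w2 i - w1 i)"
        by (simp add: embH_add w1 w2)
      then show "\<exists>d. embH (z2 + p) $ i - embH (z1 + p) $ i = 1 * of_int d" by blast
    qed (use z s in \<open>auto simp: Omega3_iff\<close>)
    then have "embH z1 = embH z2" by (simp add: vec_eq_iff embH_add fun_eq_iff)
    then show ?thesis using embH_nth[of z1] embH_nth[of z2] by (metis prod.collapse)
  qed
  ultimately show "\<exists>!z. z \<in> Z3 \<and> z + p \<in> Omega3" by blast
qed

lemma continuous_phi_embH: "continuous_on UNIV (\<lambda>p. phi m (embH p))"
  unfolding phi_def by (intro continuous_intros continuous_embH_nth)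

lemma phi_embH_periodic:
  assumes "m \<in> HH" "z \<in> Z3"
  shows "phi m (embH (z + p)) = phi m (embH p)"
proof -
  obtain w where "\<And>i. embH z $ i = of_int (w i)" "(\<Sum>i\<in>UNIV. w i) = 0"
    using Z3_embH[OF assms(2)] by blast
  then have "phi m (embH z) = 1" by (rule phi_int[OF assms(1)])
  then show ?thesis by (simp add: embH_add phi_add)
qed

lemma phi_nontrivial:
  assumes "m \<in> HH" "m \<noteq> 0"
  obtains v where "phi m (embH v) \<noteq> 1"
proof -
  let ?S = "\<Sum>i\<in>UNIV. real_of_int (m $ i) ^ 2"
  obtain i where "m $ i \<noteq> 0" using assms(2) by (auto simp: vec_eq_iff)
  then have S: "?S > 0" by (intro sum_pos2[of _ i]) auto
  \<comment> \<open>A multiple of \<open>m\<close> itself, hence of zero sum, scaled so that its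
    pairing with \<open>m\<close> is 2; the phase is then \<open>pi\<close> and the character takes
    the value -1.\<close>
  define t where "t = (\<chi> i. 2 / ?S * real_of_int (m $ i))"
  have "t \<in> RH" using HH_sum[OF assms(1)]
    by (simp add: RH_def t_def flip: sum_distrib_left of_int_sum sum_divide_distrib)
  have "(\<Sum>i\<in>UNIV. of_int (m $ i) * t $ i) = 2 / ?S * ?S"
    unfolding t_def sum_distrib_left by (rule sum.cong) (auto simp: power2_eq_square)
  then have "(\<Sum>i\<in>UNIV. of_int (m $ i) * t $ i) = 2" using S by simp
  then have "phi m t = - 1" by (simp add: phi_alt)
  then show ?thesis using that embH_surj[OF \<open>t \<in> RH\<close>] by (metis one_neq_neg_one)
qed

text \<open>For \<open>m = 0\<close> this is the volume in coordinates, compared with the cube.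
  Otherwise passing to a translate of the tile multiplies the integral by a factor different from 1,
  yet leaves it unchanged.\<close>

lemma set_integral_phi_Omega3:
  assumes "m \<in> HH"
  shows "(LINT p:Omega3|lborel. phi m (embH p)) = (if m = 0 then 1 else 0)"
proof (cases "m = 0")
  case True
  let ?C = "{0..<1} \<times> {0..<1} \<times> {0..<1} :: (real \<times> real \<times> real) set"
  have Cb: "?C \<in> sets borel" by (intro borel_Times) auto
  have "(LINT p:Omega3|lborel. (1::complex)) = (LINT p:?C|lborel. 1)"
    by (rule periodic_integral_tile_eq[OF tile_Omega3 Omega3_borel Omega3_bounded tile_cube Cb _ Z3_uminus finite_Z3_cball])
      (auto intro!: bounded_Times bounded_subset[OF bounded_closed_interval[of 0 "1::real"]])
  also have "\<dots> = 1"
  proof -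
    have "emeasure lborel ({0..<1} \<times> {0..<1} :: (real \<times> real) set) = 1"
      by (subst lborel_prod[symmetric], subst lborel.emeasure_pair_measure_Times) auto
    then have "emeasure lborel ?C = 1"
      by (subst lborel_prod[symmetric], subst lborel.emeasure_pair_measure_Times) (auto intro: borel_Times)
    then have "measure lborel ?C = 1" "emeasure lborel ?C < \<infinity>" by (simp_all add: measure_def)
    then show ?thesis
      using Cb unfolding set_lebesgue_integral_def by simp
  qed
  finally show ?thesis using True by simp
next
  case False
  obtain v where v: "phi m (embH v) \<noteq> 1" using phi_nontrivial[OF assms False] .
  let ?F = "\<lambda>p. phi m (embH p)"
  have vb: "(+) v ` Omega3 = {p. p - v \<in> Omega3}"
    by (auto simp: image_iff intro!: bexI[of _ "x - v" for x])
  have "(LINT p:Omega3|lborel. ?F p) = (LINT p:(+) v ` Omega3|lborel. ?F p)"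
  proof (rule periodic_integral_tile_eq[OF tile_Omega3 Omega3_borel Omega3_bounded
        tile_translate[OF tile_Omega3] _ _ Z3_uminus finite_Z3_cball continuous_phi_embH phi_embH_periodic[OF assms]])
    show "(+) v ` Omega3 \<in> sets borel" unfolding vb using Omega3_borel by measurable
    show "bounded ((+) v ` Omega3)" using Omega3_bounded by (rule bounded_translation)
  qed
  also have "\<dots> = (\<integral>p. indicator Omega3 (- v + p) *\<^sub>R ?F p \<partial>lborel)"
    unfolding set_lebesgue_integral_def vb by (simp add: indicator_def)
  also have "\<dots> = (\<integral>p. indicator Omega3 p *\<^sub>R ?F (v + p) \<partial>lborel)"
  proof -
    note Omega3_borel[measurable] borel_measurable_continuous_onI[OF continuous_phi_embH[of m], measurable]
    have "(\<lambda>p. indicator Omega3 (- v + p) *\<^sub>R ?F p) \<in> borel_measurable borel" by measurable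
    from integral_lborel_shift[OF this, of v] show ?thesis by simp
  qed
  also have "\<dots> = phi m (embH v) * (LINT p:Omega3|lborel. ?F p)"
    unfolding set_lebesgue_integral_def by (simp add: embH_add phi_add flip: integral_mult_right_zero)
  finally show ?thesis using v False by simp
qed

theorem theorem3p15:
  fixes n :: nat and f g :: "real^4 \<Rightarrow> complex"
  assumes "n \<ge> 1"
    and "f \<in> trig_space n" and "g \<in> trig_space n"
  shows "inner_H f g = inner_n n f g \<and> inner_n n f g = inner_n_star n f g"
proof -
  let ?H = "HH_n n"
  obtain c d where fg: "\<And>t. f t * cnj (g t) = (\<Sum>k\<in>?H. \<Sum>l\<in>?H. c k * cnj (d l) * phi (k - l) t)"
    using trig_space_product[OF assms(2,3)] by blast
  have HHd: "k - l \<in> HH" if "k \<in> ?H" "l \<in> ?H" for k l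
    using that HH_diff HH_n_HH by blast
  \<comment> \<open>The common value of the inner products, kept as a double sum to match the
    expansion of \<open>f t * cnj (g t)\<close>.\<close>
  let ?S = "\<Sum>k\<in>?H. \<Sum>l\<in>?H. c k * cnj (d l) * (if k = l then 1 else 0)"
  let ?G = "\<lambda>k l p. indicator Omega3 p *\<^sub>R (c k * cnj (d l) * phi (k - l) (embH p))"
  have int: "integrable lborel (?G k l)" for k l
    using set_integrable_bounded_continuous[OF Omega3_borel Omega3_bounded continuous_on_mult_left[OF continuous_phi_embH]]
    unfolding set_integrable_def .
  \<comment> \<open>Lebesgue integrability identifies the gauge integral in
    \<open>integral_H\<close> with the Lebesgue integral used for tiles.\<close>
  have int2: "set_integrable lborel Omega3 (\<lambda>p. \<Sum>k\<in>?H. \<Sum>l\<in>?H. c k * cnj (d l) * phi (k - l) (embH p))"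
    unfolding set_integrable_def scaleR_sum_right
    by (intro Bochner_Integration.integrable_sum int)
  \<comment> \<open>The normalisation 1/2 cancels the Jacobian factor 2.\<close>
  have "inner_H f g = integral Omega3 (\<lambda>p. \<Sum>k\<in>?H. \<Sum>l\<in>?H. c k * cnj (d l) * phi (k - l) (embH p))"
    by (simp add: inner_H_def integral_H_def fg Omega3_def)
  also have "\<dots> = (\<integral>p. (\<Sum>k\<in>?H. \<Sum>l\<in>?H. ?G k l p) \<partial>lborel)"
    using set_borel_integral_eq_integral(2)[OF int2] by (simp add: set_lebesgue_integral_def scaleR_sum_right)
  also have "\<dots> = (\<Sum>k\<in>?H. \<integral>p. (\<Sum>l\<in>?H. ?G k l p) \<partial>lborel)"
    by (intro Bochner_Integration.integral_sum Bochner_Integration.integrable_sum int)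
  also have "\<dots> = (\<Sum>k\<in>?H. \<Sum>l\<in>?H. \<integral>p. ?G k l p \<partial>lborel)"
    by (intro sum.cong refl Bochner_Integration.integral_sum int)
  also have "\<dots> = (\<Sum>k\<in>?H. \<Sum>l\<in>?H. c k * cnj (d l) * (LINT p:Omega3|lborel. phi (k - l) (embH p)))"
    by (simp only: set_lebesgue_integral_def mult_scaleR_right[symmetric] integral_mult_right_zero)
  also have "\<dots> = ?S"
    by (intro sum.cong refl) (simp add: set_integral_phi_Omega3[OF HHd])
  finally have 1: "inner_H f g = ?S" .
  have "inner_n n f g = (1 / (4 * of_nat n ^ 3)) *
    (\<Sum>k\<in>?H. \<Sum>l\<in>?H. c k * cnj (d l) * (\<Sum>j\<in>?H. phi (k - l) (grid_pt n j)))"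
    unfolding inner_n_def fg sum_distrib_left
    by (subst sum.swap, rule sum.cong[OF refl], rule sum.swap)
  also have "\<dots> = (1 / (4 * of_nat n ^ 3)) *
    (\<Sum>k\<in>?H. \<Sum>l\<in>?H. (4 * of_nat n ^ 3) * (c k * cnj (d l) * (if k = l then 1 else 0)))"
    by (rule arg_cong2[where f = "(*)", OF refl], rule sum.cong[OF refl], rule sum.cong[OF refl])
      (simp add: sum_phi_HH_n[OF assms(1)])
  also have "\<dots> = ?S"
    using assms(1) by (simp flip: sum_distrib_left)
  finally have 2: "inner_n n f g = ?S" .
  have "inner_n_star n f g = (1 / (4 * of_nat n ^ 3)) *
    (\<Sum>j\<in>HH_n_star n. of_real (weight n j) * (f (grid_pt n j) * cnj (g (grid_pt n j))))"
    unfolding inner_n_star_def by (simp only: mult.assoc)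
  also have "\<dots> = inner_n n f g"
  proof -
    \<comment> \<open>All frequencies \<open>k - l\<close> in the product lie in \<open>HH\<close>,
      so it is constant on lattice classes and the weighted sum collapses.\<close>
    have "f (grid_pt n j) * cnj (g (grid_pt n j)) = f (grid_pt n k) * cnj (g (grid_pt n k))"
      if "j \<in> HH" "k \<in> HH" "lat_eq n j k" for j k
      unfolding fg using phi_lat_eq[OF assms(1) HHd that] by simp
    from sum_HH_n_star_weight[OF assms(1), of "\<lambda>j. f (grid_pt n j) * cnj (g (grid_pt n j))", OF this]
    show ?thesis unfolding inner_n_def by simp
  qed
  finally show ?thesis using 1 2 by simp
qed

end
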